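(* Let $n\ge 2$, $p,q\geq 2$ be integers, $\mathcal{U}=(u_{i_1\ldots i_p})\in\mathbb{T}(\mathbb{C}^n,p)$ and $\mathcal{V}=(v_{i_1\ldots i_q})\in\mathbb{T}(\mathbb{C}^n,q)$. Define $\mathcal{W}\in\mathbb{T}(\mathbb{C}^n,1+(p-1)(q-1))$ by $$w_{iJ_2\ldots J_p}:=\sum_{i_2,\ldots,i_p=1}^n u_{ii_2\ldots i_p}\,v_{i_2J_2}\cdots v_{i_pJ_p},$$ for $i\in\{1,\ldots,n\}$ and multi-indices $J_l=(j_{(l,2)},\ldots,j_{(l,q)})\in\{1,\ldots,n\}^{q-1}$, $l=2,\ldots,p$. Then $\hat{\mathcal{W}}=\hat{\mathcal{U}}\circ\hat{\mathcal{V}}$ as maps $\mathbb{C}^n\to\mathbb{C}^n$.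
   Context: $\mathbb{T}(\mathbb{C}^n,m)$ is the space of $m$-th order $n$-dimensional complex tensors $\mathcal{T}=(t_{i_1\ldots i_m})$, $1\le i_1,\ldots,i_m\le n$. For $\mathbf{x}\in\mathbb{C}^n$, $\mathcal{T}\mathbf{x}^{m-1}\in\mathbb{C}^n$ is the vector with $i$-th entry $\sum_{i_2,\ldots,i_m=1}^n t_{ii_2\ldots i_m}x_{i_2}\cdots x_{i_m}$. $\hat{\mathcal{T}}:\mathbb{C}^n\to\mathbb{C}^n$ denotes the homogeneous polynomial map $\mathbf{x}\mapsto\mathcal{T}\mathbf{x}^{m-1}$. *)

theory Defs
  imports "HOL-Analysis.Finite_Cartesian_Product"
begin

text \<open>
  The index set \<open>{1,...,n}\<close> is a finite type \<open>'n\<close> with \<open>n = CARD('n)\<close>, and complex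
  \<open>n\<close>-space is \<^typ>\<open>complex ^ 'n\<close>. The entry of a tensor at \<open>(i\<^sub>1,...,i\<^sub>m)\<close> is its value
  at the list \<open>[i\<^sub>1,...,i\<^sub>m]\<close>.
\<close>

definition multi_indices :: "nat \<Rightarrow> 'n list set" where
  "multi_indices k = {I. length I = k}"

text \<open>
  Tensors vanish at lists of the wrong length, so that two elements of the space with the
  same entries are equal.
\<close>

definition tensor_space :: "nat \<Rightarrow> ('n list \<Rightarrow> complex) set" where
  "tensor_space m = {T. \<forall>I. I \<notin> multi_indices m \<longrightarrow> T I = 0}"

definition tensor_map :: "nat \<Rightarrow> ('n::finite list \<Rightarrow> complex) \<Rightarrow> complex ^ 'n \<Rightarrow> complex ^ 'n" where
  "tensor_map m T x =
    (\<chi> i. \<Sum>I\<in>multi_indices (m - 1). T (i # I) * (\<Prod>k<m - 1. x $ (I ! k)))"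

text \<open>
  An index of a tensor of order \<open>1 + (p-1)(q-1)\<close> is uniquely \<open>i # concat Js\<close>, where \<open>Js\<close>
  consists of \<open>p-1\<close> multi-indices of length \<open>q-1\<close>. Positions in lists start at 0, so
  \<open>Js ! l\<close> is \<open>J\<^bsub>l+2\<^esub>\<close> and \<open>I ! l\<close> is \<open>i\<^bsub>l+2\<^esub>\<close>.
\<close>

definition is_tensor_composite ::
  "nat \<Rightarrow> nat \<Rightarrow> ('n::finite list \<Rightarrow> complex) \<Rightarrow> ('n list \<Rightarrow> complex) \<Rightarrow> ('n list \<Rightarrow> complex) \<Rightarrow> bool"
where
  "is_tensor_composite p q U V W \<longleftrightarrow>
    W \<in> tensor_space (1 + (p - 1) * (q - 1)) \<and>
    (\<forall>i. \<forall>Js. length Js = p - 1 \<and> set Js \<subseteq> multi_indices (q - 1) \<longrightarrow>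
      W (i # concat Js) =
        (\<Sum>I\<in>multi_indices (p - 1). U (i # I) * (\<Prod>l<p - 1. V (I ! l # Js ! l))))"

lemma ex_blocks:
  assumes "length L = a * b"
  shows "\<exists>Js. length Js = a \<and> set Js \<subseteq> multi_indices b \<and> concat Js = L"
  using assms
proof (induction a arbitrary: L)
  case 0
  then show ?case by simp
next
  case (Suc a)
  have "length (drop b L) = a * b" using Suc.prems by simp
  then obtain Js where "length Js = a" "set Js \<subseteq> multi_indices b" "concat Js = drop b L"
    using Suc.IH by blast
  moreover have "length (take b L) = b" using Suc.prems by simp
  ultimately show ?case
    by (intro exI[of _ "take b L # Js"]) (auto simp: multi_indices_def)
qed

lemma blocks_unique:
  assumes "length Js = a" "length Ks = a" "set Js \<subseteq> multi_indices b" "set Ks \<subseteq> multi_indices b"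
    and "concat Js = concat Ks"
  shows "Js = Ks"
proof -
  have "\<forall>(x, y) \<in> set (zip Js Ks). length x = length y"
    using assms(3,4) by (fastforce simp: multi_indices_def dest: set_zip_leftD set_zip_rightD)
  with assms(1,2,5) show ?thesis by (simp add: concat_eq_concat_iff)
qed

lemma length_concat_blocks:
  "set Js \<subseteq> multi_indices b \<Longrightarrow> length (concat Js) = length Js * b"
  by (induction Js) (auto simp: multi_indices_def)

lemma tensor_composite_exists_unique: "\<exists>!W. is_tensor_composite p q U V W"
proof -
  define blocks where "blocks L = (THE Js. length Js = p - 1 \<and>
    set Js \<subseteq> multi_indices (q - 1) \<and> concat Js = L)" for L :: "'a list"
  have blocks: "blocks (concat Js) = Js"
    if "length Js = p - 1" "set Js \<subseteq> multi_indices (q - 1)" for Js :: "'a list list"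
    unfolding blocks_def using that by (intro the_equality) (auto intro: blocks_unique)
  define W where "W L = (if length L = 1 + (p - 1) * (q - 1) then
      \<Sum>I\<in>multi_indices (p - 1). U (hd L # I) * (\<Prod>l<p - 1. V (I ! l # blocks (tl L) ! l))
    else 0)" for L
  show ?thesis
  proof (rule ex1I)
    show "is_tensor_composite p q U V W"
      unfolding is_tensor_composite_def
      by (auto simp: W_def tensor_space_def multi_indices_def[of "Suc _"]
          length_concat_blocks blocks)
  next
    fix X assume X: "is_tensor_composite p q U V X"
    show "X = W"
    proof
      fix L :: "'a list"
      show "X L = W L"
      proof (cases "length L = 1 + (p - 1) * (q - 1)")
        case False
        with X show ?thesis
          by (simp add: is_tensor_composite_def tensor_space_def multi_indices_def W_def)
      next
        case True
        then obtain i M where L: "L = i # M" "length M = (p - 1) * (q - 1)"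
          by (cases L) auto
        then obtain Js where Js: "length Js = p - 1" "set Js \<subseteq> multi_indices (q - 1)"
          "concat Js = M"
          using ex_blocks by blast
        have "X (i # concat Js) =
          (\<Sum>I\<in>multi_indices (p - 1). U (i # I) * (\<Prod>l<p - 1. V (I ! l # Js ! l)))"
          using X Js unfolding is_tensor_composite_def by blast
        then show ?thesis using True L Js blocks[of Js] by (simp add: W_def)
      qed
    qed
  qed
qed

end

theory Submission imports Defs begin

text \<open>Entry \<open>i\<close> of U applied to the vector \<open>tensor_map q V x\<close> is a
  sum over \<open>I\<close> of \<open>U (i # I)\<close> times a product of \<open>p - 1\<close>
  entries of that vector, each a sum over multi-indices of length \<open>q - 1\<close>. Expanding
  the product (\<open>prod_sum_lists\<close>) gives a sum over lists \<open>Js\<close> of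
  \<open>p - 1\<close> blocks. After exchanging the sums over \<open>I\<close> and
  \<open>Js\<close>, the coefficient of the monomial of \<open>Js\<close>
  (\<open>prod_nth_concat\<close>) is the defining formula for \<open>W (i # concat Js)\<close>.
  Concatenation matches the lists \<open>Js\<close> with the tail indices of W
  (\<open>bij_betw_concat_blocks\<close>).\<close>

lemma finite_multi_indices [simp]: "finite (multi_indices k :: 'n::finite list set)"
  using finite_lists_length_eq[of "UNIV :: 'n set" k] by (simp add: multi_indices_def)

text \<open>General distributivity: a term of the expansion picks one summand from each factor. The
  choices are recorded as lists so that, for \<open>A\<close> a set of multi-indices, they are
  exactly the block lists \<open>Js\<close>.\<close>

lemma prod_sum_lists:
  fixes f :: "nat \<Rightarrow> 'a \<Rightarrow> 'b::comm_semiring_1"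
  assumes "finite A"
  shows "(\<Prod>l<n. \<Sum>x\<in>A. f l x) =
    (\<Sum>xs | length xs = n \<and> set xs \<subseteq> A. \<Prod>l<n. f l (xs ! l))"
proof (induction n arbitrary: f)
  case 0
  have "{xs :: 'a list. length xs = 0 \<and> set xs \<subseteq> A} = {[]}" by auto
  then show ?case by simp
next
  case (Suc n)
  let ?B = "\<lambda>n. {xs. length xs = n \<and> set xs \<subseteq> A}"
  have B: "?B (Suc n) = (\<lambda>(x, xs). x # xs) ` (A \<times> ?B n)"
    by (auto simp: length_Suc_conv)
  \<comment> \<open>Splitting off factor 0 moves the other positions down by one, hence the
    induction hypothesis at the shifted family.\<close>
  have "(\<Prod>l<Suc n. \<Sum>x\<in>A. f l x) =
      (\<Sum>x\<in>A. f 0 x) * (\<Sum>xs\<in>?B n. \<Prod>l<n. f (Suc l) (xs ! l))"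
    using Suc.IH[of "\<lambda>l. f (Suc l)"] by (simp add: prod.lessThan_Suc_shift del: prod.lessThan_Suc)
  also have "\<dots> = (\<Sum>(x, xs)\<in>A \<times> ?B n. f 0 x * (\<Prod>l<n. f (Suc l) (xs ! l)))"
    by (simp add: sum_product sum.cartesian_product)
  also have "\<dots> = (\<Sum>xs\<in>?B (Suc n). \<Prod>l<Suc n. f l (xs ! l))"
    unfolding B
    by (subst sum.reindex)
      (auto simp: inj_on_def prod.lessThan_Suc_shift simp del: prod.lessThan_Suc intro!: sum.cong)
  finally show ?case .
qed

text \<open>Cutting a list at multiples of \<open>b\<close> inverts \<open>concat\<close>. Fixing
  the number \<open>a\<close> of blocks keeps this true even for \<open>b = 0\<close>.\<close>

lemma bij_betw_concat_blocks:
  "bij_betw concat {Js. length Js = a \<and> set Js \<subseteq> multi_indices b} (multi_indices (a * b))"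
proof (rule bij_betw_imageI)
  show "inj_on concat {Js. length Js = a \<and> set Js \<subseteq> multi_indices b}"
    by (auto intro!: inj_onI blocks_unique)
  show "concat ` {Js. length Js = a \<and> set Js \<subseteq> multi_indices b} = multi_indices (a * b)"
  proof
    show "concat ` {Js. length Js = a \<and> set Js \<subseteq> multi_indices b} \<subseteq> multi_indices (a * b)"
      by (auto simp: multi_indices_def[of "a * b"] length_concat_blocks)
    show "multi_indices (a * b) \<subseteq> concat ` {Js. length Js = a \<and> set Js \<subseteq> multi_indices b}"
      using ex_blocks[of _ a b] by (force simp: multi_indices_def[of "a * b"])
  qed
qed

lemma prod_nth_eq_prod_list:
  fixes f :: "'a \<Rightarrow> 'b::comm_monoid_mult"
  shows "(\<Prod>k<length xs. f (xs ! k)) = prod_list (map f xs)"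
  by (simp add: prod.list_conv_set_nth atLeast0LessThan)

text \<open>Both sides multiply \<open>f\<close> over all entries, the right one grouped by block.
  Passing through \<open>prod_list\<close> avoids computing positions by division with
  remainder.\<close>

lemma prod_nth_concat:
  fixes f :: "'a \<Rightarrow> 'b::comm_monoid_mult"
  assumes "length Js = a" "set Js \<subseteq> multi_indices b"
  shows "(\<Prod>k<a * b. f (concat Js ! k)) = (\<Prod>l<a. \<Prod>k<b. f (Js ! l ! k))"
proof -
  have "(\<Prod>k<a * b. f (concat Js ! k)) = prod_list (map f (concat Js))"
    using prod_nth_eq_prod_list[of f "concat Js"] assms by (simp add: length_concat_blocks)
  also have "\<dots> = prod_list (map (\<lambda>J. prod_list (map f J)) Js)"
    by (induction Js) auto
  also have "\<dots> = (\<Prod>l<a. prod_list (map f (Js ! l)))"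
    using prod_nth_eq_prod_list[of "\<lambda>J. prod_list (map f J)" Js] assms(1) by simp
  also have "\<dots> = (\<Prod>l<a. \<Prod>k<b. f (Js ! l ! k))"
  proof (intro prod.cong refl)
    fix l assume "l \<in> {..<a}"
    with assms have "Js ! l \<in> multi_indices b" by (auto dest: nth_mem)
    then show "prod_list (map f (Js ! l)) = (\<Prod>k<b. f (Js ! l ! k))"
      using prod_nth_eq_prod_list[of f "Js ! l"] by (simp add: multi_indices_def)
  qed
  finally show ?thesis .
qed

theorem proposition4p1:
  fixes U V W :: "'n::finite list \<Rightarrow> complex" and p q :: nat
  assumes "CARD('n) \<ge> 2" and "p \<ge> 2" and "q \<ge> 2"
    and "U \<in> tensor_space p" and "V \<in> tensor_space q"
    and "is_tensor_composite p q U V W"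
  shows "tensor_map (1 + (p - 1) * (q - 1)) W = tensor_map p U \<circ> tensor_map q V"
proof
  fix x :: "complex ^ 'n"
  define a b where "a = p - 1" and "b = q - 1"
  define B where "B = {Js :: 'n list list. length Js = a \<and> set Js \<subseteq> multi_indices b}"
  have "(\<Sum>L\<in>multi_indices (a * b). W (i # L) * (\<Prod>k<a * b. x $ (L ! k))) =
      (\<Sum>I\<in>multi_indices a. U (i # I) *
        (\<Prod>l<a. \<Sum>J\<in>multi_indices b. V (I ! l # J) * (\<Prod>k<b. x $ (J ! k))))" for i
  proof -
    have "(\<Sum>L\<in>multi_indices (a * b). W (i # L) * (\<Prod>k<a * b. x $ (L ! k))) =
        (\<Sum>Js\<in>B. W (i # concat Js) * (\<Prod>k<a * b. x $ (concat Js ! k)))"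
      unfolding B_def by (rule sum.reindex_bij_betw[OF bij_betw_concat_blocks, symmetric])
    \<comment> \<open>The monomial splits along the blocks, so its \<open>l\<close>-th part joins
      the \<open>l\<close>-th factor coming from V.\<close>
    also have "\<dots> = (\<Sum>Js\<in>B. \<Sum>I\<in>multi_indices a. U (i # I) *
        (\<Prod>l<a. V (I ! l # Js ! l) * (\<Prod>k<b. x $ (Js ! l ! k))))"
    proof (rule sum.cong)
      fix Js assume "Js \<in> B"
      then have Js: "length Js = a" "set Js \<subseteq> multi_indices b" by (auto simp: B_def)
      with assms(6) have "W (i # concat Js) =
          (\<Sum>I\<in>multi_indices a. U (i # I) * (\<Prod>l<a. V (I ! l # Js ! l)))"
        unfolding is_tensor_composite_def a_def b_def by blast
      then show "W (i # concat Js) * (\<Prod>k<a * b. x $ (concat Js ! k)) =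
          (\<Sum>I\<in>multi_indices a. U (i # I) *
            (\<Prod>l<a. V (I ! l # Js ! l) * (\<Prod>k<b. x $ (Js ! l ! k))))"
        by (simp add: prod_nth_concat[OF Js, of "($) x"] sum_distrib_right prod.distrib mult.assoc)
    qed simp
    \<comment> \<open>\<open>U (i # I)\<close> does not depend on \<open>Js\<close>; once the sums
      are exchanged, the inner sum over \<open>B\<close> is an expanded product of entries of
      \<open>tensor_map q V x\<close>.\<close>
    also have "\<dots> = (\<Sum>I\<in>multi_indices a. U (i # I) *
        (\<Sum>Js\<in>B. \<Prod>l<a. V (I ! l # Js ! l) * (\<Prod>k<b. x $ (Js ! l ! k))))"
      unfolding sum_distrib_left by (rule sum.swap)
    finally show ?thesis
      unfolding B_def by (simp add: prod_sum_lists)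
  qed
  then show "tensor_map (1 + (p - 1) * (q - 1)) W x = (tensor_map p U \<circ> tensor_map q V) x"
    by (simp add: tensor_map_def vec_eq_iff a_def b_def)
qed

end
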